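(* Let $\{A(t)\}_{t\ge0}$ be a discrete time chain of $N\times N$ row-stochastic matrices. If the opinion network $x(t+1)=A(t)x(t)$, $t\ge t_0$, is initialized at a sufficiently large time $t_0$, then the size of its smallest Éminence Grise Coalition (EGC) is $\mathbf{rank}(A)$. Here "sufficiently large" means that $t_0\ge T$, where $T$ is a time such that $\dim(\mathbf{null}_\tau(A))$ is constant for $\tau\ge T$.
   Context: Time indices are non-negative integers; $\mathcal V=\{1,\dots,N\}$. A discrete time chain is a sequence $\{A(t)\}_{t\ge0}$ of $N\times N$ row-stochastic matrices. Its state transition matrix is $\Phi(t,\tau)=A(t-1)\cdots A(\tau)$ for $t>\tau\ge0$, and $\Phi(t,t)=I$. For $\tau\ge0$, $\mathbf{null}_\tau(A)=\{v\in\mathbb R^N:\lim_{t\to\infty}\Phi(t,\tau)v=\mathbf 0_N\}$, a vector space. Its dimension is non-increasing in $\tau$, hence constant after a finite time. Define $\mathbf{nullity}(A)=\lim_{\tau\to\infty}\dim(\mathbf{null}_\tau(A))$ and $\mathbf{rank}(A)=N-\mathbf{nullity}(A)$. EGC: for the network with initial time $t_0$, a subset $\mathcal S\subset\mathcal V$ is an EGC if for every $x^*\in\mathbb R$ and every choice of initial values $x_i(t_0)$, $i\in\mathcal V\setminus\mathcal S$, there is a choice of initial values $x_i(t_0)$, $i\in\mathcal S$, such that $\lim_{t\to\infty}x(t)=x^*\mathbf 1_N$, where $\mathbf 1_N$ is the all-ones vector. *)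

theory Defs
  imports "HOL-Analysis.Analysis"
begin

definition row_stochastic :: "real^'n^'n \<Rightarrow> bool" where
  "row_stochastic M \<longleftrightarrow> (\<forall>i j. 0 \<le> M $ i $ j) \<and> (\<forall>i. (\<Sum>j\<in>UNIV. M $ i $ j) = 1)"

definition discrete_time_chain :: "(nat \<Rightarrow> real^'n^'n) \<Rightarrow> bool" where
  "discrete_time_chain A \<longleftrightarrow> (\<forall>t. row_stochastic (A t))"

(* For t > s this is A(t-1) ** ... ** A(s); it is the identity for t = s, and also
   (by convention, never used) for t < s. *)
primrec transition :: "(nat \<Rightarrow> real^'n^'n) \<Rightarrow> nat \<Rightarrow> nat \<Rightarrow> real^'n^'n" where
  "transition A 0 s = mat 1"
| "transition A (Suc t) s = (if s \<le> t then A t ** transition A t s else mat 1)"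

definition null_space :: "(nat \<Rightarrow> real^'n^'n) \<Rightarrow> nat \<Rightarrow> (real^'n) set" where
  "null_space A s = {v. (\<lambda>t. transition A t s *v v) \<longlonglongrightarrow> 0}"

(* The limit of a sequence of natural numbers in the discrete topology, i.e. its
   eventual value; that it exists is shown below. *)
definition chain_nullity :: "(nat \<Rightarrow> real^'n^'n) \<Rightarrow> nat" where
  "chain_nullity A = lim (\<lambda>s. dim (null_space A s))"

definition chain_rank :: "(nat \<Rightarrow> real^'n^'n) \<Rightarrow> nat" where
  "chain_rank A = CARD('n) - chain_nullity A" for A :: "nat \<Rightarrow> real^'n^'n"

definition opinion_network :: "(nat \<Rightarrow> real^'n^'n) \<Rightarrow> nat \<Rightarrow> (nat \<Rightarrow> real^'n) \<Rightarrow> bool" where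
  "opinion_network A t0 x \<longleftrightarrow> (\<forall>t\<ge>t0. x (Suc t) = A t *v x t)"

(* Only the values y i with i outside S matter. A trajectory x is determined from time t0
   onwards by x t0, so the existential choice of x is the choice of the initial
   values x t0 $ i for i in S. *)
definition EGC :: "(nat \<Rightarrow> real^'n^'n) \<Rightarrow> nat \<Rightarrow> 'n set \<Rightarrow> bool" where
  "EGC A t0 S \<longleftrightarrow>
     (\<forall>(c::real) (y :: 'n \<Rightarrow> real). \<exists>x. opinion_network A t0 x \<and>
        (\<forall>i\<in>-S. x t0 $ i = y i) \<and> x \<longlonglongrightarrow> c *\<^sub>R (\<chi> i. 1))"

definition smallest_EGC :: "(nat \<Rightarrow> real^'n^'n) \<Rightarrow> nat \<Rightarrow> 'n set \<Rightarrow> bool" where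
  "smallest_EGC A t0 S \<longleftrightarrow> EGC A t0 S \<and> (\<forall>S'. EGC A t0 S' \<longrightarrow> card S \<le> card S')"

lemma transition_shift:
  "s < t \<Longrightarrow> transition A t s = transition A t (Suc s) ** A s"
proof (induction t)
  case (Suc t)
  show ?case
  proof (cases "s = t")
    case True
    have "transition A s s = mat 1" by (cases s) auto
    then show ?thesis using True by simp
  next
    case False
    then show ?thesis using Suc by (simp add: matrix_mul_assoc)
  qed
qed simp

lemma subspace_null_space: "subspace (null_space A s)"
proof (rule subspaceI)
  fix x y assume "x \<in> null_space A s" "y \<in> null_space A s"
  then show "x + y \<in> null_space A s"
    using tendsto_add[of "\<lambda>t. transition A t s *v x" 0 sequentially "\<lambda>t. transition A t s *v y" 0]
    by (simp add: null_space_def matrix_vector_right_distrib)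
next
  fix c x assume "x \<in> null_space A s"
  then show "c *\<^sub>R x \<in> null_space A s"
    using tendsto_scaleR[OF tendsto_const, of "\<lambda>t. transition A t s *v x" 0 sequentially c]
    by (simp add: null_space_def matrix_vector_mult_scaleR)
qed (simp add: null_space_def)

lemma null_space_vimage: "v \<in> null_space A s \<longleftrightarrow> A s *v v \<in> null_space A (Suc s)"
proof -
  have "eventually (\<lambda>t. transition A t s *v v = transition A t (Suc s) *v (A s *v v)) sequentially"
    using eventually_gt_at_top[of s]
    by eventually_elim (simp add: transition_shift matrix_vector_mul_assoc)
  then show ?thesis unfolding null_space_def mem_Collect_eq by (rule tendsto_cong)
qed

lemma dim_null_space_Suc: "dim (null_space A (Suc s)) \<le> dim (null_space A s)"
  for A :: "nat \<Rightarrow> real^'n^'n"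
proof -
  define M where "M = A s"
  define P where "P = null_space A s"
  define Q where "Q = null_space A (Suc s)"
  define R where "R = orthogonal_comp Q"
  have RQ: "orthogonal_comp R = Q"
    unfolding R_def Q_def by (rule orthogonal_comp_self[OF subspace_null_space])
  have orth: "dim (orthogonal_comp X) + dim X = CARD('n)" for X :: "(real^'n) set"
  proof -
    have "dim (orthogonal_comp (span X)) + dim (span X) = CARD('n)"
      using dim_subspace_orthogonal_to_vectors[of "span X" UNIV]
      by (simp add: orthogonal_comp_def)
    moreover have "orthogonal_comp (span X) = orthogonal_comp X"
      unfolding orthogonal_comp_def
      by (auto intro: span_base) (metis orthogonal_commute orthogonal_to_span)
    ultimately show ?thesis by simp
  qed
  have adj: "orthogonal (transpose M *v y) v \<longleftrightarrow> orthogonal y (M *v v)" for y v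
    by (simp only: orthogonal_def dot_lmul_matrix transpose_matrix_vector)
  have mem: "v \<in> P \<longleftrightarrow> (\<forall>y\<in>R. orthogonal y (M *v v))" for v
  proof -
    have "v \<in> P \<longleftrightarrow> M *v v \<in> orthogonal_comp R"
      unfolding RQ unfolding P_def Q_def M_def by (rule null_space_vimage)
    then show ?thesis by (simp only: orthogonal_comp_def mem_Collect_eq)
  qed
  have P: "P = orthogonal_comp ((*v) (transpose M) ` R)"
    by (rule set_eqI) (simp only: mem orthogonal_comp_def mem_Collect_eq ball_simps adj)
  have "dim ((*v) (transpose M) ` R) \<le> dim R"
    by (rule dim_image_le) (rule matrix_vector_mul_linear)
  then show ?thesis
    using orth[of R, unfolded RQ] orth[of "(*v) (transpose M) ` R", folded P]
    unfolding P_def[symmetric] Q_def[symmetric] by linarith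
qed

lemma dim_null_space_eventually_constant:
  "\<exists>T. \<forall>s\<ge>T. dim (null_space A s) = dim (null_space A T)"
proof -
  obtain T where T: "\<And>s. dim (null_space A T) \<le> dim (null_space A s)"
    using ex_has_least_nat[of "\<lambda>_. True" 0 "\<lambda>s. dim (null_space A s)"] by auto
  have "antimono (\<lambda>s. dim (null_space A s))"
    by (rule decseq_SucI) (rule dim_null_space_Suc)
  then show ?thesis using T by (metis antimonoD le_antisym)
qed

lemma chain_nullity_eq:
  assumes "\<forall>s\<ge>T. dim (null_space A s) = dim (null_space A T)"
  shows "chain_nullity A = dim (null_space A T)"
proof -
  have "(\<lambda>s. dim (null_space A s)) \<longlonglongrightarrow> dim (null_space A T)"
    by (intro tendsto_eventually eventually_sequentiallyI[of T]) (rule assms[rule_format])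
  then show ?thesis unfolding chain_nullity_def by (rule limI)
qed

end

theory Submission
  imports Defs
begin

text \<open>
  Since row-stochastic matrices fix the all-ones vector, the trajectory started at \<open>v\<close> at time
  \<open>t0\<close> tends to consensus at \<open>c\<close> exactly if \<open>v\<close> minus the constant vector \<open>c\<close> lies in the null
  space at \<open>t0\<close>. Hence \<open>S\<close> is an EGC iff the null space projects onto the coordinates outside
  \<open>S\<close>, that is, iff the null space and the unit vectors indexed by \<open>S\<close> span the whole space.
  Counting dimensions gives the lower bound, and extending a basis of the null space by unit
  vectors gives a coalition that attains it.
\<close>

lemma transition_self: "transition A s s = mat 1"
  by (cases s) auto

lemma row_stochastic_mult_ones:
  fixes M :: "real^'n^'n"
  assumes "row_stochastic M"
  shows "M *v (c *\<^sub>R (\<chi> i. 1)) = c *\<^sub>R (\<chi> i. 1)"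
  using assms
  by (simp add: row_stochastic_def vec_eq_iff matrix_vector_mult_def flip: sum_distrib_right)

text \<open>No condition \<open>s \<le> t\<close> is required: below the initial time the transition
  matrix is the identity by convention, which also fixes constant vectors.\<close>

lemma transition_mult_ones:
  fixes A :: "nat \<Rightarrow> real^'n^'n"
  assumes "discrete_time_chain A"
  shows "transition A t s *v (c *\<^sub>R (\<chi> i. 1)) = c *\<^sub>R (\<chi> i. 1)"
proof (induction t)
  case (Suc t)
  have "row_stochastic (A t)"
    using assms by (simp add: discrete_time_chain_def)
  with Suc show ?case
    by (simp add: row_stochastic_mult_ones flip: matrix_vector_mul_assoc)
qed simp

lemma opinion_network_eq_transition:
  assumes "opinion_network A t0 x" "t0 \<le> t"
  shows "x t = transition A t t0 *v x t0"
  using assms(2)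
proof (induction t rule: dec_induct)
  case base
  show ?case by (simp add: transition_self)
next
  case (step t)
  then show ?case
    using assms(1) by (simp add: opinion_network_def matrix_vector_mul_assoc)
qed

lemma opinion_network_transition: "opinion_network A t0 (\<lambda>t. transition A t t0 *v v)"
  by (simp add: opinion_network_def matrix_vector_mul_assoc)

lemma transition_consensus_iff:
  fixes A :: "nat \<Rightarrow> real^'n^'n"
  assumes "discrete_time_chain A"
  shows "(\<lambda>t. transition A t s *v v) \<longlonglongrightarrow> c *\<^sub>R (\<chi> i. 1) \<longleftrightarrow>
         v - c *\<^sub>R (\<chi> i. 1) \<in> null_space A s"
  unfolding null_space_def mem_Collect_eq matrix_vector_mult_diff_distrib
    transition_mult_ones[OF assms]
  by (rule LIM_zero_iff[symmetric])

lemma EGC_iff_projection: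
  fixes A :: "nat \<Rightarrow> real^'n^'n"
  assumes "discrete_time_chain A"
  shows "EGC A t0 S \<longleftrightarrow> (\<forall>y::real^'n. \<exists>v\<in>null_space A t0. \<forall>i\<in>-S. v $ i = y $ i)"
proof
  assume EGC: "EGC A t0 S"
  show "\<forall>y::real^'n. \<exists>v\<in>null_space A t0. \<forall>i\<in>-S. v $ i = y $ i"
  proof
    fix y :: "real^'n"
    \<comment> \<open>The consensus value 0 alone yields the projection property: a trajectory
      tending to 0 must start in the null space.\<close>
    obtain x where x: "opinion_network A t0 x" "\<forall>i\<in>-S. x t0 $ i = y $ i"
        "x \<longlonglongrightarrow> 0 *\<^sub>R (\<chi> i. 1)"
      using EGC unfolding EGC_def by blast
    \<comment> \<open>Before \<open>t0\<close> the sequence \<open>x\<close> is arbitrary, so the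
      two sequences agree only eventually; this suffices for limits.\<close>
    have "eventually (\<lambda>t. x t = transition A t t0 *v x t0) sequentially"
      using eventually_ge_at_top[of t0]
      by eventually_elim (rule opinion_network_eq_transition[OF x(1)])
    then have "(\<lambda>t. transition A t t0 *v x t0) \<longlonglongrightarrow> 0 *\<^sub>R (\<chi> i. 1)"
      using x(3) tendsto_cong by fast
    then have "x t0 \<in> null_space A t0"
      by (simp add: null_space_def)
    then show "\<exists>v\<in>null_space A t0. \<forall>i\<in>-S. v $ i = y $ i"
      using x(2) by blast
  qed
next
  assume *: "\<forall>y::real^'n. \<exists>v\<in>null_space A t0. \<forall>i\<in>-S. v $ i = y $ i"
  show "EGC A t0 S"
    unfolding EGC_def
  proof (intro allI)
    fix c :: real and y :: "'n \<Rightarrow> real"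
    \<comment> \<open>Prescribing \<open>y i - c\<close> compensates for the constant vector added
      back in \<open>w\<close>.\<close>
    obtain v where v: "v \<in> null_space A t0" "\<forall>i\<in>-S. v $ i = y i - c"
      using spec[OF *, of "\<chi> i. y i - c"] by auto
    define w where "w = v + c *\<^sub>R (\<chi> i. 1)"
    have "(\<lambda>t. transition A t t0 *v w) \<longlonglongrightarrow> c *\<^sub>R (\<chi> i. 1)"
      unfolding transition_consensus_iff[OF assms] using v(1) by (simp add: w_def)
    moreover have "\<forall>i\<in>-S. (transition A t0 t0 *v w) $ i = y i"
      using v(2) by (simp add: transition_self w_def)
    ultimately show "\<exists>x. opinion_network A t0 x \<and> (\<forall>i\<in>-S. x t0 $ i = y i) \<and>
        x \<longlonglongrightarrow> c *\<^sub>R (\<chi> i. 1)"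
      using opinion_network_transition[of A t0 w] by blast
  qed
qed

lemma span_axis_image:
  "span ((\<lambda>i. axis i 1) ` S) = {v::real^'n. \<forall>i\<in>-S. v $ i = 0}"
proof (intro equalityI subsetI)
  fix v :: "real^'n"
  assume "v \<in> span ((\<lambda>i. axis i 1) ` S)"
  then show "v \<in> {v. \<forall>i\<in>-S. v $ i = 0}"
    by (induction rule: span_induct_alt) (auto simp: axis_def)
next
  fix v :: "real^'n"
  assume v: "v \<in> {v. \<forall>i\<in>-S. v $ i = 0}"
  have "v = (\<Sum>i\<in>UNIV. v $ i *\<^sub>R axis i 1)"
    by (simp add: basis_expansion flip: scalar_mult_eq_scaleR)
  also have "\<dots> = (\<Sum>i\<in>S. v $ i *\<^sub>R axis i 1)"
    using v by (intro sum.mono_neutral_right) auto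
  also have "\<dots> \<in> span ((\<lambda>i. axis i 1) ` S)"
    by (intro span_sum span_scale span_base) auto
  finally show "v \<in> span ((\<lambda>i. axis i 1) ` S)" .
qed

text \<open>The unit vectors indexed by \<open>S\<close> span the kernel of the projection onto the
  coordinates outside \<open>S\<close>. Hence \<open>y\<close> lies in the sum of \<open>V\<close>
  and this kernel iff some \<open>v\<close> in \<open>V\<close> has the same projection as
  \<open>y\<close>; the kernel part is then \<open>y - v\<close>.\<close>

lemma projection_onto_iff_span:
  fixes V :: "(real^'n) set"
  assumes "subspace V"
  shows "(\<forall>y::real^'n. \<exists>v\<in>V. \<forall>i\<in>-S. v $ i = y $ i) \<longleftrightarrow>
         span (V \<union> (\<lambda>i. axis i 1) ` S) = UNIV"
proof -
  have "y \<in> span (V \<union> (\<lambda>i. axis i 1) ` S) \<longleftrightarrow> (\<exists>v\<in>V. \<forall>i\<in>-S. v $ i = y $ i)" for y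
  proof -
    have "y \<in> span (V \<union> (\<lambda>i. axis i 1) ` S) \<longleftrightarrow>
        (\<exists>v\<in>V. \<exists>e. (\<forall>i\<in>-S. e $ i = 0) \<and> y = v + e)"
      unfolding span_Un span_axis_image span_eq_iff[THEN iffD2, OF assms] by blast
    also have "\<dots> \<longleftrightarrow> (\<exists>v\<in>V. \<forall>i\<in>-S. v $ i = y $ i)"
    proof (rule bex_cong[OF refl])
      fix v
      show "(\<exists>e. (\<forall>i\<in>-S. e $ i = 0) \<and> y = v + e) \<longleftrightarrow> (\<forall>i\<in>-S. v $ i = y $ i)"
        by (auto intro!: exI[of _ "y - v"])
    qed
    finally show ?thesis .
  qed
  then show ?thesis by blast
qed

text \<open>A basis of \<open>V\<close> together with the unit vectors indexed by \<open>S\<close>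
  still spans the whole space, and it has at most \<open>dim V + card S\<close> elements.\<close>

lemma codim_le_card_if_span_axis:
  fixes V :: "(real^'n) set"
  assumes "span (V \<union> (\<lambda>i. axis i 1) ` S) = UNIV"
  shows "CARD('n) - dim V \<le> card S"
proof -
  obtain B where B: "B \<subseteq> V" "independent B" "V \<subseteq> span B" "card B = dim V"
    using basis_exists by blast
  have fin: "finite (B \<union> (\<lambda>i. axis i 1) ` S)"
    using B(2) by (simp add: independent_imp_finite)
  have "V \<union> (\<lambda>i. axis i 1) ` S \<subseteq> span (B \<union> (\<lambda>i. axis i 1) ` S)"
    using B(3) span_mono[of B "B \<union> (\<lambda>i. axis i 1) ` S"] by (auto intro: span_base)
  then have "UNIV \<subseteq> span (B \<union> (\<lambda>i. axis i 1) ` S)"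
    using assms span_minimal subspace_span by metis
  then have "dim (UNIV :: (real^'n) set) \<le> card (B \<union> (\<lambda>i. axis i 1) ` S)"
    using fin by (intro dim_le_card)
  also have "\<dots> \<le> card B + card ((\<lambda>i. axis i 1 :: real^'n) ` S)"
    by (rule card_Un_le)
  also have "\<dots> \<le> dim V + card S"
    using B(4) by (simp add: card_image_le)
  finally show ?thesis by simp
qed

text \<open>Steinitz extension: a basis \<open>B\<close> of \<open>V\<close> is completed by unit
  vectors to a basis \<open>C\<close> of the whole space, and \<open>S\<close> indexes the vectors
  added.\<close>

lemma span_axis_complement_exists:
  fixes V :: "(real^'n) set"
  obtains S where "span (V \<union> (\<lambda>i. axis i 1) ` S) = UNIV" "card S = CARD('n) - dim V"
proof -
  obtain B where B: "B \<subseteq> V" "independent B" "V \<subseteq> span B" "card B = dim V"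
    using basis_exists by blast
  define E :: "(real^'n) set" where "E = range (\<lambda>i. axis i 1)"
  have span_E: "span E = UNIV"
    unfolding E_def span_axis_image by simp
  obtain C where C: "B \<subseteq> C" "C \<subseteq> B \<union> E" "independent C" "B \<union> E \<subseteq> span C"
    using maximal_independent_subset_extend[of B "B \<union> E"] B(2) by blast
  \<comment> \<open>Removing \<open>B\<close> matters, since \<open>B\<close> may itself contain
    unit vectors, which must not count towards \<open>S\<close>.\<close>
  define S where "S = {i. axis i 1 \<in> C - B}"
  have image_S: "(\<lambda>i. axis i 1) ` S = C - B"
    using C(2) by (auto simp: S_def E_def)
  have "UNIV \<subseteq> span C"
    using C(4) span_minimal[of E "span C"] span_E by auto
  moreover have "C \<subseteq> V \<union> (\<lambda>i. axis i 1) ` S"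
    using B(1) image_S by auto
  ultimately have "span (V \<union> (\<lambda>i. axis i 1) ` S) = UNIV"
    using span_mono by blast
  moreover have "card S = CARD('n) - dim V"
  proof -
    have "inj_on (\<lambda>i. axis i 1 :: real^'n) S"
      by (auto simp: inj_on_def axis_eq_axis)
    then have "card S = card (C - B)"
      using card_image image_S by metis
    also have "\<dots> = card C - card B"
      using C(1) B(2) by (simp add: card_Diff_subset independent_imp_finite)
    also have "card C = CARD('n)"
      using \<open>UNIV \<subseteq> span C\<close> C(3) basis_card_eq_dim[of C UNIV] by simp
    finally show ?thesis using B(4) by simp
  qed
  ultimately show thesis by (rule that)
qed

theorem corollary7:
  fixes A :: "nat \<Rightarrow> real^'n^'n" and T t0 :: nat
  assumes "discrete_time_chain A"
    and "\<forall>s\<ge>T. dim (null_space A s) = dim (null_space A T)"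
    and "t0 \<ge> T"
  shows "\<exists>S. smallest_EGC A t0 S \<and> card S = chain_rank A"
proof -
  \<comment> \<open>As \<open>t0 \<ge> T\<close>, the null space at \<open>t0\<close> already has
    the limiting dimension.\<close>
  have rank: "chain_rank A = CARD('n) - dim (null_space A t0)"
    unfolding chain_rank_def chain_nullity_eq[OF assms(2)]
    using assms(2)[rule_format, OF assms(3)] by simp
  have EGC: "EGC A t0 S \<longleftrightarrow> span (null_space A t0 \<union> (\<lambda>i. axis i 1) ` S) = UNIV" for S
    unfolding EGC_iff_projection[OF assms(1)]
    by (rule projection_onto_iff_span[OF subspace_null_space])
  obtain S where S: "EGC A t0 S" "card S = chain_rank A"
    using span_axis_complement_exists[of "null_space A t0"] EGC rank by metis
  \<comment> \<open>Every rival coalition also satisfies the span condition, so the dimension count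
    bounds its size below by the rank.\<close>
  then have "smallest_EGC A t0 S"
    unfolding smallest_EGC_def using EGC rank codim_le_card_if_span_axis by metis
  then show ?thesis using S(2) by blast
qed

end
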